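(* Let $n,\ell\ge 1$ and define $\phi_{\mathbb{C}}:\mathbb{C}^{n\times\ell}\to\mathbb{C}^{\ell\times\ell}$ by $\phi_{\mathbb{C}}(A)=\sqrt{A^\star A}$, where $\sqrt{A^\star A}$ is the unique positive semi-definite hermitian matrix whose square is $A^\star A$. Then $$d_{\mathrm{U}(n)}(A,B)\leq d(\phi_{\mathbb{C}}(A),\phi_{\mathbb{C}}(B))\leq\sqrt2\,d_{\mathrm{U}(n)}(A,B)$$ for all $A,B\in\mathbb{C}^{n\times\ell}$. The image of $\phi_{\mathbb{C}}$ is contained in the real subspace $\mathcal{H}(\mathbb{C}^\ell)\subseteq\mathbb{C}^{\ell\times\ell}$ of real dimension $\ell^2$ consisting of all hermitian matrices.
   Context: $B^\star$ is the conjugate transpose of $B$. On complex matrix spaces, $\langle A,B\rangle=\operatorname{trace}(AB^\star)$, $\|A\|=\sqrt{\langle A,A\rangle}$ and $d(A,B)=\|A-B\|$. The unitary group $\mathrm{U}(n)$ acts on $\mathbb{C}^{n\times\ell}$ by left multiplication, and $d_{\mathrm{U}(n)}(A,B)=\min_{g\in\mathrm{U}(n)}\|gA-B\|$. *)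

theory Defs
  imports "HOL-Analysis.Analysis"
begin

definition ctranspose :: "complex^'m^'n \<Rightarrow> complex^'n^'m" where
  "ctranspose A = (\<chi> i j. cnj (A $ j $ i))"

definition mat_inner :: "complex^'m^'n \<Rightarrow> complex^'m^'n \<Rightarrow> complex" where
  "mat_inner A B = trace (A ** ctranspose B)"

(* mat_inner A A is a nonnegative real; Re only converts the type. *)
definition mat_norm :: "complex^'m^'n \<Rightarrow> real" where
  "mat_norm A = sqrt (Re (mat_inner A A))"

definition mat_dist :: "complex^'m^'n \<Rightarrow> complex^'m^'n \<Rightarrow> real" where
  "mat_dist A B = mat_norm (A - B)"

definition unitary_group :: "(complex^'n^'n) set" where
  "unitary_group = {g. ctranspose g ** g = mat 1 \<and> g ** ctranspose g = mat 1}"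

(* A minimum, not merely an infimum; it is attained by unitary_dist_attained below. *)
definition unitary_dist :: "complex^'m^'n \<Rightarrow> complex^'m^'n \<Rightarrow> real" where
  "unitary_dist A B = (LEAST r. \<exists>g\<in>unitary_group. r = mat_norm (g ** A - B))"

definition hermitian_mats :: "(complex^'n^'n) set" where
  "hermitian_mats = {M. ctranspose M = M}"

definition pos_semidef :: "complex^'n^'n \<Rightarrow> bool" where
  "pos_semidef M \<longleftrightarrow>
     M \<in> hermitian_mats \<and> (\<forall>x. (\<Sum>i\<in>UNIV. cnj (x $ i) * (M *v x) $ i) \<in> \<real>\<^sub>\<ge>\<^sub>0)"

definition psd_sqrt :: "complex^'n^'n \<Rightarrow> complex^'n^'n" where
  "psd_sqrt M = (THE P. pos_semidef P \<and> P ** P = M)"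

definition phi_C :: "complex^'m^'n \<Rightarrow> complex^'m^'m" where
  "phi_C A = psd_sqrt (ctranspose A ** A)"

lemma mat_inner_self: "mat_inner A A = of_real ((norm A)\<^sup>2)"
proof -
  have "mat_inner A A = (\<Sum>i\<in>UNIV. \<Sum>j\<in>UNIV. A$i$j * cnj (A$i$j))"
    by (simp add: mat_inner_def trace_def matrix_matrix_mult_def ctranspose_def)
  also have "\<dots> = of_real (\<Sum>i\<in>UNIV. \<Sum>j\<in>UNIV. (norm (A$i$j))\<^sup>2)"
    by (simp only: of_real_sum complex_norm_square)
  also have "(\<Sum>i\<in>UNIV. \<Sum>j\<in>UNIV. (norm (A$i$j))\<^sup>2) = (norm A)\<^sup>2"
    by (simp add: norm_vec_def L2_set_def sum_nonneg)
  finally show ?thesis .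
qed

lemma mat_norm_eq_norm: "mat_norm A = norm A"
  by (simp add: mat_norm_def mat_inner_self)

lemma one_in_unitary_group: "mat 1 \<in> unitary_group"
proof -
  have "ctranspose (mat 1 :: complex^'n^'n) = mat 1"
    by (simp add: ctranspose_def mat_def vec_eq_iff)
  then show ?thesis by (simp add: unitary_group_def)
qed

lemma compact_unitary_group: "compact (unitary_group :: (complex^'n^'n) set)"
proof -
  have "norm g = sqrt (real CARD('n))" if "g \<in> unitary_group" for g :: "complex^'n^'n"
  proof -
    have "mat_inner g g = of_nat CARD('n)"
      using that by (simp add: mat_inner_def unitary_group_def trace_def mat_def)
    then show ?thesis by (simp add: mat_norm_def flip: mat_norm_eq_norm)
  qed
  then have "bounded (unitary_group :: (complex^'n^'n) set)"
    by (intro boundedI[where B = "sqrt (real CARD('n))"]) simp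
  moreover have "closed (unitary_group :: (complex^'n^'n) set)"
    unfolding unitary_group_def ctranspose_def matrix_matrix_mult_def
    by (intro closed_Collect_conj closed_Collect_eq continuous_intros)
  ultimately show ?thesis by (simp add: compact_eq_bounded_closed)
qed

lemma unitary_dist_attained:
  fixes A B :: "complex^'m^'n"
  shows "\<exists>g\<in>unitary_group. unitary_dist A B = mat_norm (g ** A - B) \<and>
           (\<forall>h\<in>unitary_group. mat_norm (g ** A - B) \<le> mat_norm (h ** A - B))"
proof -
  have "continuous_on unitary_group (\<lambda>g :: complex^'n^'n. mat_norm (g ** A - B))"
    unfolding mat_norm_eq_norm matrix_matrix_mult_def by (intro continuous_intros)
  moreover have "(unitary_group :: (complex^'n^'n) set) \<noteq> {}"
    using one_in_unitary_group by blast
  ultimately obtain g :: "complex^'n^'n" where g: "g \<in> unitary_group"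
    "\<forall>h\<in>unitary_group. mat_norm (g ** A - B) \<le> mat_norm (h ** A - B)"
    using continuous_attains_inf[OF compact_unitary_group] by meson
  then have "unitary_dist A B = mat_norm (g ** A - B)"
    unfolding unitary_dist_def by (intro Least_equality) auto
  with g show ?thesis by auto
qed

end

theory Submission
  imports Defs
begin

text \<open>Write \<open>A = U P\<close> and \<open>B = V Q\<close> with \<open>P = \<phi> A\<close>, \<open>Q = \<phi> B\<close> and partial isometries \<open>U\<close>, \<open>V\<close>, and let
  \<open>X \<bullet> Y\<close> be the real part of the trace of \<open>X Y\<^sup>*\<close>. Both bounds compare \<open>P \<bullet> Q\<close> with \<open>A \<bullet> B\<close>, because
  \<open>\<phi>\<close> preserves norms.

  For the lower bound choose \<open>g\<close> unitary with \<open>g A B\<^sup>* = R\<^sup>2\<close> positive semidefinite. Then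
  \<open>P \<bullet> Q = (R V) \<bullet> (R g U)\<close> is at most \<open>R \<bullet> R = (g A) \<bullet> B\<close>, since multiplying by a partial
  isometry does not increase the norm.

  For the upper bound write \<open>P = R\<^sup>2\<close>, \<open>Q = S\<^sup>2\<close>. Then \<open>A \<bullet> B = (S V\<^sup>* U R) \<bullet> (S R)\<close>, so
  \<open>2 (A \<bullet> B)\<close> is at most \<open>P \<bullet> Q + (U P U\<^sup>*) \<bullet> (V Q V\<^sup>*)\<close>, whose last term is at most half the sum of
  the squared norms of \<open>A\<close> and \<open>B\<close>.

  The unitary \<open>g\<close> and the spectral theorem both come from maximising a function over the compact
  unitary group and testing the maximum against \<open>1 + (z - 1) E\<close>, where \<open>E\<close> is a rank-one
  projector and \<open>z\<close> lies on the unit circle.\<close>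

section \<open>Conjugate transpose and the real trace inner product\<close>

lemma ctranspose_mult: "ctranspose (A ** B) = ctranspose B ** ctranspose A"
  by (simp add: ctranspose_def matrix_matrix_mult_def vec_eq_iff mult.commute)

lemma ctranspose_ctranspose [simp]: "ctranspose (ctranspose A) = A"
  by (simp add: ctranspose_def vec_eq_iff)

lemma ctranspose_add: "ctranspose (A + B) = ctranspose A + ctranspose B"
  by (simp add: ctranspose_def vec_eq_iff)

lemma ctranspose_diff: "ctranspose (A - B) = ctranspose A - ctranspose B"
  by (simp add: ctranspose_def vec_eq_iff)

lemma ctranspose_mat_1 [simp]: "ctranspose (mat 1) = mat 1"
  by (simp add: ctranspose_def mat_def vec_eq_iff)

lemma matrix_add_rdistrib: "(B + C) ** A = B ** A + C ** (A :: complex^'m^'k)"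
  by (simp add: matrix_matrix_mult_def vec_eq_iff sum.distrib algebra_simps)

lemma matrix_diff_ldistrib: "A ** (B - C) = A ** B - A ** (C :: complex^'m^'k)"
  by (simp add: matrix_matrix_mult_def vec_eq_iff sum_subtractf algebra_simps)

lemma matrix_diff_rdistrib: "(B - C) ** A = B ** A - C ** (A :: complex^'m^'k)"
  by (simp add: matrix_matrix_mult_def vec_eq_iff sum_subtractf algebra_simps)

lemma matrix_mult_zero_left [simp]: "0 ** A = (0 :: complex^'m^'n)"
  by (simp add: matrix_matrix_mult_def vec_eq_iff)

lemma matrix_mult_zero_right [simp]: "A ** 0 = (0 :: complex^'m^'n)"
  by (simp add: matrix_matrix_mult_def vec_eq_iff)

lemma trace_ctranspose: "trace (ctranspose A) = cnj (trace A)"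
  by (simp add: trace_def ctranspose_def)

lemma trace_mult_commute:
  fixes A :: "complex^'m^'n" and B :: "complex^'n^'m"
  shows "trace (A ** B) = trace (B ** A)"
  by (simp add: trace_def matrix_matrix_mult_def mult.commute) (rule sum.swap)

lemma inner_matrix_eq: "A \<bullet> B = Re (trace (A ** ctranspose B))"
  for A B :: "complex^'m^'n"
  by (simp add: inner_vec_def inner_complex_def trace_def matrix_matrix_mult_def ctranspose_def)

text \<open>Cyclicity of the trace: left multiplication by \<open>X\<close> has adjoint left
  multiplication by \<open>ctranspose X\<close>. With \<open>inner_mult_right\<close> it lets
  factors move across the inner product in every later estimate.\<close>

lemma inner_mult_left:
  fixes X :: "complex^'m^'n" and A :: "complex^'k^'m"
  shows "(X ** A) \<bullet> B = A \<bullet> (ctranspose X ** B)"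
  unfolding inner_matrix_eq ctranspose_mult ctranspose_ctranspose
  by (metis matrix_mul_assoc trace_mult_commute)

lemma inner_mult_right:
  fixes A :: "complex^'m^'n" and X :: "complex^'k^'m"
  shows "(A ** X) \<bullet> B = A \<bullet> (B ** ctranspose X)"
  unfolding inner_matrix_eq ctranspose_mult ctranspose_ctranspose
  by (metis matrix_mul_assoc)

lemma inner_ctranspose: "ctranspose A \<bullet> ctranspose B = A \<bullet> B"
  for A B :: "complex^'m^'n"
  by (simp add: inner_vec_def inner_complex_def ctranspose_def) (rule sum.swap)

section \<open>Positive semidefinite matrices\<close>

definition qform :: "complex^'n^'n \<Rightarrow> complex^'n \<Rightarrow> complex" where
  "qform M x = (\<Sum>i\<in>UNIV. cnj (x $ i) * (M *v x) $ i)"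

lemma pos_semidef_iff: "pos_semidef M \<longleftrightarrow> ctranspose M = M \<and> (\<forall>x. qform M x \<in> \<real>\<^sub>\<ge>\<^sub>0)"
  by (simp add: pos_semidef_def hermitian_mats_def qform_def)

lemma qform_diff: "qform (M - N) x = qform M x - qform N x"
  by (simp add: qform_def matrix_vector_mult_diff_rdistrib sum_subtractf algebra_simps)

lemma qform_ctranspose: "qform (ctranspose M) x = cnj (qform M x)"
  unfolding qform_def matrix_vector_mult_def ctranspose_def
  by (simp add: sum_distrib_left mult_ac) (rule sum.swap)

lemma qform_congruence:
  fixes M :: "complex^'n^'n" and C :: "complex^'m^'n"
  shows "qform (ctranspose C ** M ** C) x = qform M (C *v x)"
proof -
  have "qform (ctranspose C ** M ** C) x
      = (\<Sum>i\<in>UNIV. cnj (x $ i) * (ctranspose C *v (M *v (C *v x))) $ i)"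
    by (simp add: qform_def matrix_vector_mul_assoc matrix_mul_assoc)
  also have "\<dots> = (\<Sum>i\<in>UNIV. \<Sum>k\<in>UNIV. cnj (C $ k $ i * x $ i) * (M *v (C *v x)) $ k)"
    by (subst matrix_vector_mult_def) (simp add: ctranspose_def sum_distrib_left mult_ac)
  also have "\<dots> = (\<Sum>k\<in>UNIV. \<Sum>i\<in>UNIV. cnj (C $ k $ i * x $ i) * (M *v (C *v x)) $ k)"
    by (rule sum.swap)
  also have "\<dots> = qform M (C *v x)"
    unfolding qform_def
    by (intro sum.cong refl) (simp add: matrix_vector_mult_def flip: sum_distrib_right)
  finally show ?thesis .
qed

lemma pos_semidef_congruence:
  fixes C :: "complex^'m^'n"
  assumes "pos_semidef M"
  shows "pos_semidef (ctranspose C ** M ** C)"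
  using assms by (simp add: pos_semidef_iff qform_congruence ctranspose_mult matrix_mul_assoc)

lemma qform_mat_1: "qform (mat 1) x = of_real ((norm x)\<^sup>2)"
proof -
  have "qform (mat 1) x = of_real (\<Sum>i\<in>UNIV. (norm (x $ i))\<^sup>2)"
    by (simp add: qform_def complex_norm_square mult.commute del: of_real_power)
  then show ?thesis by (simp add: norm_vec_def L2_set_def sum_nonneg)
qed

lemma pos_semidef_gram: "pos_semidef (ctranspose A ** A)" for A :: "complex^'m^'n"
proof -
  have "pos_semidef (mat 1 :: complex^'n^'n)"
    by (simp add: pos_semidef_iff qform_mat_1 del: of_real_power)
  from pos_semidef_congruence[OF this, of A] show ?thesis by simp
qed

lemma qform_axis_pair:
  assumes "i \<noteq> j"
  shows "qform M (axis i 1 + axis j c)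
       = M $ i $ i + c * M $ i $ j + cnj c * M $ j $ i + cnj c * c * M $ j $ j"
proof -
  have "M *v (axis i 1 + axis j c) = (\<chi> k. M $ k $ i + c * M $ k $ j)"
    by (simp add: matrix_vector_right_distrib vec_eq_iff)
       (simp add: matrix_vector_mult_def axis_def if_distrib[of "(*) _"] mult.commute cong: if_cong)
  moreover have "cnj ((axis i 1 + axis j c) $ k) = (if k = i then 1 else 0) + (if k = j then cnj c else 0)"
    for k using assms by (simp add: axis_def)
  ultimately show ?thesis
    by (simp add: qform_def distrib_right sum.distrib if_distrib[of "\<lambda>x. x * _"] cong: if_cong)
       (simp add: algebra_simps)
qed

lemma qform_axis: "qform M (axis i 1) = M $ i $ i"
proof -
  have "cnj (axis i (1::complex) $ k) = (if k = i then 1 else 0)" for k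
    by (simp add: axis_def)
  then show ?thesis
    by (simp add: qform_def if_distrib[of "\<lambda>x. x * _"] cong: if_cong)
       (simp add: matrix_vector_mult_def axis_def if_distrib[of "(*) _"] cong: if_cong)
qed

text \<open>Polarisation: coefficient \<open>1\<close> gives the sum and coefficient
  \<open>\<i>\<close> the difference of two opposite off-diagonal entries, so both vanish.\<close>

lemma qform_eq_0_imp_eq_0:
  assumes "\<And>x. qform N x = 0"
  shows "N = 0"
proof -
  have diag: "N $ i $ i = 0" for i
    using assms[of "axis i 1"] by (simp add: qform_axis)
  have "N $ i $ j = 0" if "i \<noteq> j" for i j
  proof -
    have "N $ i $ j + N $ j $ i = 0"
      using assms[of "axis i 1 + axis j 1"] that by (simp add: qform_axis_pair diag)
    moreover have "\<i> * (N $ i $ j - N $ j $ i) = 0"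
      using assms[of "axis i 1 + axis j \<i>"] that by (simp add: qform_axis_pair diag algebra_simps)
    ultimately show ?thesis by (simp add: complex_eq_iff)
  qed
  with diag show ?thesis by (metis vec_eq_iff zero_index)
qed

lemma hermitian_if_qform_real:
  assumes "\<And>x. Im (qform M x) = 0"
  shows "ctranspose M = M"
proof -
  have "qform (ctranspose M - M) x = 0" for x
    using assms[of x] by (simp add: qform_diff qform_ctranspose complex_eq_iff)
  then show ?thesis using qform_eq_0_imp_eq_0 by (metis eq_iff_diff_eq_0)
qed

section \<open>Rank-one variations in the unitary group\<close>

lemma unitary_group_mult: "g \<in> unitary_group \<Longrightarrow> h \<in> unitary_group \<Longrightarrow> g ** h \<in> unitary_group"
  unfolding unitary_group_def mem_Collect_eq ctranspose_mult
  by (metis matrix_mul_assoc matrix_mul_rid)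

definition cscale :: "complex \<Rightarrow> complex^'m^'n \<Rightarrow> complex^'m^'n" where
  "cscale c A = (\<chi> i j. c * A $ i $ j)"

lemma cscale_mult_left: "cscale c A ** B = cscale c (A ** B)"
  by (simp add: cscale_def matrix_matrix_mult_def vec_eq_iff sum_distrib_left mult_ac)

lemma cscale_mult_right: "A ** cscale c B = cscale c (A ** B)"
  by (simp add: cscale_def matrix_matrix_mult_def vec_eq_iff sum_distrib_left mult_ac)

lemma cscale_cscale: "cscale c (cscale d A) = cscale (c * d) A"
  by (simp add: cscale_def vec_eq_iff mult_ac)

lemma cscale_add: "cscale (c + d) A = cscale c A + cscale d A"
  by (simp add: cscale_def vec_eq_iff algebra_simps)

lemma cscale_add_right: "cscale c (A + B) = cscale c A + cscale c B"
  by (simp add: cscale_def vec_eq_iff algebra_simps)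

lemma cscale_0 [simp]: "cscale 0 A = 0"
  by (simp add: cscale_def vec_eq_iff)

lemma trace_cscale: "trace (cscale c A) = c * trace A"
  by (simp add: cscale_def trace_def sum_distrib_left)

lemma ctranspose_cscale: "ctranspose (cscale c A) = cscale (cnj c) (ctranspose A)"
  by (simp add: cscale_def ctranspose_def vec_eq_iff)

text \<open>The matrix acts as \<open>1 + w\<close> on the range of \<open>E\<close> and as the
  identity on its orthogonal complement. Unitarity amounts to
  \<open>w + cnj w + w * cnj w = 0\<close>, which is the unit modulus of \<open>1 + w\<close>
  expanded.\<close>

lemma unitary_of_projector:
  assumes E: "ctranspose E = E" "E ** E = E" and w: "cmod (1 + w) = 1"
  shows "mat 1 + cscale w E \<in> unitary_group"
proof -
  have "(1 + w) * (1 + cnj w) = 1"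
    using complex_norm_square[of "1 + w"] w by simp
  then have "w + cnj w + w * cnj w = 0"
    by (simp add: algebra_simps)
  then have "cscale w E + cscale (cnj w) E + cscale (w * cnj w) E = 0"
    by (simp flip: cscale_add)
  then show ?thesis
    using E by (simp add: unitary_group_def ctranspose_add ctranspose_cscale matrix_add_ldistrib
        matrix_add_rdistrib cscale_add_right cscale_mult_left cscale_mult_right cscale_cscale add_ac mult.commute)
qed

text \<open>The orthogonal projector onto the line through \<open>x\<close>; for
  \<open>x = 0\<close> it is the zero matrix, since division by zero gives zero.\<close>

definition projector :: "complex^'n \<Rightarrow> complex^'n^'n" where
  "projector x = (\<chi> i j. x $ i * cnj (x $ j) / of_real ((norm x)\<^sup>2))"

lemma trace_mult_projector: "trace (M ** projector x) = qform M x / of_real ((norm x)\<^sup>2)"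
  by (simp add: trace_def matrix_matrix_mult_def projector_def qform_def matrix_vector_mult_def
      sum_distrib_left sum_divide_distrib mult_ac del: of_real_power)

lemma ctranspose_projector: "ctranspose (projector x) = projector x"
  by (simp add: projector_def ctranspose_def vec_eq_iff mult.commute)

lemma projector_idem:
  assumes "x \<noteq> 0"
  shows "projector x ** projector x = projector x"
proof -
  define s where "s = complex_of_real ((norm x)\<^sup>2)"
  have s: "s \<noteq> 0" using assms by (simp add: s_def)
  have "(\<Sum>k\<in>UNIV. cnj (x $ k) * x $ k) = s"
    using qform_mat_1[of x] by (simp add: qform_def s_def)
  then have "(\<Sum>k\<in>UNIV. x $ i * cnj (x $ k) / s * (x $ k * cnj (x $ j) / s))
      = x $ i * cnj (x $ j) / s" for i j
  proof -
    assume *: "(\<Sum>k\<in>UNIV. cnj (x $ k) * x $ k) = s"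
    have "(\<Sum>k\<in>UNIV. x $ i * cnj (x $ k) / s * (x $ k * cnj (x $ j) / s))
        = (x $ i * cnj (x $ j) / (s * s)) * (\<Sum>k\<in>UNIV. cnj (x $ k) * x $ k)"
      unfolding sum_distrib_left by (intro sum.cong refl) (simp add: field_simps)
    then show ?thesis using * s by simp
  qed
  then show ?thesis
    by (simp add: projector_def matrix_matrix_mult_def vec_eq_iff s_def)
qed

text \<open>Take \<open>g\<close> maximising the real part of the trace of \<open>g ** M\<close>. If
  some value \<open>q\<close> of the form were not a nonnegative real, turning its phase along the
  line through \<open>x\<close> would increase that trace.\<close>

lemma ex_unitary_mult_psd:
  fixes M :: "complex^'n^'n"
  shows "\<exists>g\<in>unitary_group. pos_semidef (g ** M)"
proof -
  have "continuous_on unitary_group (\<lambda>g :: complex^'n^'n. Re (trace (g ** M)))"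
    unfolding trace_def matrix_matrix_mult_def by (intro continuous_intros)
  moreover have "(unitary_group :: (complex^'n^'n) set) \<noteq> {}"
    using one_in_unitary_group by blast
  ultimately obtain g :: "complex^'n^'n" where g: "g \<in> unitary_group"
    and max: "\<And>h. h \<in> unitary_group \<Longrightarrow> Re (trace (h ** M)) \<le> Re (trace (g ** M))"
    using continuous_attains_sup[OF compact_unitary_group] by meson
  have nonneg: "qform (g ** M) x \<in> \<real>\<^sub>\<ge>\<^sub>0" for x
  proof (cases "x = 0 \<or> qform (g ** M) x = 0")
    case True
    then show ?thesis by (auto simp: qform_def)
  next
    case False
    define q where "q = qform (g ** M) x"
    \<comment> \<open>Chosen so that \<open>(1 + w) * q = cmod q\<close>: the variation rotates
      \<open>q\<close> onto the nonnegative real axis.\<close>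
    define w where "w = cnj q / of_real (cmod q) - 1"
    have q: "q \<noteq> 0" and x: "x \<noteq> 0" using False by (auto simp: q_def)
    have w: "cmod (1 + w) = 1" using q by (simp add: w_def norm_divide)
    have "w * q = of_real (cmod q) - q"
      using q by (simp add: w_def algebra_simps complex_norm_square[symmetric] power2_eq_square)
    have "mat 1 + cscale w (projector x) \<in> unitary_group"
      by (intro unitary_of_projector ctranspose_projector projector_idem x w)
    from max[OF unitary_group_mult[OF this g]]
    have "Re (trace (cscale w (projector x) ** (g ** M))) \<le> 0"
      by (simp add: matrix_add_rdistrib trace_add flip: matrix_mul_assoc)
    also have "trace (cscale w (projector x) ** (g ** M)) = (w * q) / of_real ((norm x)\<^sup>2)"
      by (simp add: cscale_mult_left trace_cscale trace_mult_commute[of "projector x"]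
          trace_mult_projector q_def)
    finally have "Re (w * q) \<le> 0"
      using x by (simp add: divide_le_0_iff del: of_real_power)
    with \<open>w * q = _\<close> have "cmod q \<le> Re q" by simp
    moreover have "(cmod q)\<^sup>2 = (Re q)\<^sup>2 + (Im q)\<^sup>2" by (rule cmod_power2)
    ultimately have "Im q = 0" "Re q \<ge> 0"
      using complex_Re_le_cmod[of q] norm_ge_zero[of q] by (auto simp: order_antisym_conv)
    then show ?thesis by (simp add: complex_nonneg_Reals_iff q_def)
  qed
  have "ctranspose (g ** M) = g ** M"
    using nonneg by (intro hermitian_if_qform_real) (simp add: complex_nonneg_Reals_iff)
  with nonneg g show ?thesis by (auto simp: pos_semidef_iff)
qed

section \<open>Spectral theorem\<close>

definition diag_mat :: "('n \<Rightarrow> real) \<Rightarrow> complex^'n^'n" where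
  "diag_mat d = (\<chi> i j. if i = j then of_real (d i) else 0)"

lemma ctranspose_diag_mat: "ctranspose (diag_mat d) = diag_mat d"
  by (simp add: ctranspose_def diag_mat_def vec_eq_iff)

lemma diag_mat_mult_nth: "(diag_mat d ** M) $ i $ j = of_real (d i) * M $ i $ j"
  by (simp add: diag_mat_def matrix_matrix_mult_def if_distrib[of "\<lambda>x. x * _"] cong: if_cong)

lemma mult_diag_mat_nth: "(M ** diag_mat d) $ i $ j = M $ i $ j * of_real (d j)"
  by (simp add: diag_mat_def matrix_matrix_mult_def if_distrib[of "(*) _"] cong: if_cong)

lemma diag_mat_mult: "diag_mat d ** diag_mat e = diag_mat (\<lambda>i. d i * e i)"
  by (simp add: vec_eq_iff diag_mat_mult_nth) (simp add: diag_mat_def)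

lemma pos_semidef_diag_mat_iff: "pos_semidef (diag_mat d) \<longleftrightarrow> (\<forall>i. d i \<ge> 0)"
proof
  assume "pos_semidef (diag_mat d)"
  then have "qform (diag_mat d) (axis i 1) \<in> \<real>\<^sub>\<ge>\<^sub>0" for i
    by (simp add: pos_semidef_iff)
  then show "\<forall>i. d i \<ge> 0"
    by (simp add: qform_axis diag_mat_def)
next
  assume d: "\<forall>i. d i \<ge> 0"
  have "qform (diag_mat d) x = of_real (\<Sum>i\<in>UNIV. d i * (cmod (x $ i))\<^sup>2)" for x
    by (simp add: qform_def matrix_vector_mult_def diag_mat_def if_distrib[of "\<lambda>x. x * _"]
        if_distrib[of "(*) _"] complex_norm_square mult_ac cong: if_cong del: of_real_power)
  with d show "pos_semidef (diag_mat d)"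
    by (simp add: pos_semidef_iff ctranspose_diag_mat sum_nonneg del: of_real_sum)
qed

lemma linear_coeff_eq_0:
  fixes k b :: real
  assumes "\<And>s. s\<^sup>2 * k \<le> s * b"
  shows "b = 0"
proof (rule ccontr)
  assume b: "b \<noteq> 0"
  \<comment> \<open>For \<open>s = - b * t\<close> the hypothesis, divided by
    \<open>b\<^sup>2 * t\<close>, reads \<open>t * k \<le> -1\<close>, while this \<open>t\<close>
    makes the modulus of \<open>t * k\<close> less than 1.\<close>
  define t where "t = 1 / (\<bar>k\<bar> + 1)"
  have t: "t > 0" by (simp add: t_def)
  have "(b\<^sup>2 * t) * (t * k) \<le> (b\<^sup>2 * t) * (-1)"
    using assms[of "- b * t"] by (simp add: power2_eq_square mult_ac)
  then have "t * k \<le> -1"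
    using b t by (subst (asm) mult_le_cancel_left_pos) auto
  then show False
    by (simp add: t_def field_simps split: if_splits)
qed

text \<open>The first-order condition at the maximum \<open>u = 1\<close>, tested on all rank-one
  projectors, says that the form of \<open>H ** D\<close> is real. Hence \<open>H ** D\<close> is
  hermitian, and for hermitian factors this means that they commute.\<close>

lemma commute_if_trace_maximal:
  fixes D H :: "complex^'n^'n"
  assumes D: "ctranspose D = D" and H: "ctranspose H = H"
    and max: "\<And>u. u \<in> unitary_group \<Longrightarrow> (u ** H ** ctranspose u) \<bullet> D \<le> H \<bullet> D"
  shows "H ** D = D ** H"
proof -
  have "Im (qform (H ** D) x) = 0" for x
  proof (cases "x = 0")
    case True
    then show ?thesis by (simp add: qform_def)
  next
    case x: False
    define E where "E = projector x"
    have E: "ctranspose E = E" "E ** E = E"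
      using x by (simp_all add: E_def ctranspose_projector projector_idem)
    define a where "a = trace (H ** D ** E)"
    define c where "c = Re (trace (E ** H ** E ** D))"
    \<comment> \<open>Insert \<open>u = 1 + w E\<close>. The two linear terms are complex conjugates
      of each other because \<open>H\<close>, \<open>D\<close> and \<open>E\<close> are hermitian;
      \<open>c\<close> is the coefficient of the quadratic term.\<close>
    have ineq: "2 * Re (w * a) + (cmod w)\<^sup>2 * c \<le> 0" if w: "cmod (1 + w) = 1" for w
    proof -
      define u where "u = mat 1 + cscale w E"
      have "u \<in> unitary_group" using unitary_of_projector[OF E w] by (simp add: u_def)
      moreover have "u ** H ** ctranspose u = H + cscale w (E ** H) + cscale (cnj w) (H ** E)
          + cscale (w * cnj w) (E ** H ** E)"
        by (simp add: u_def ctranspose_add ctranspose_cscale E matrix_add_ldistrib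
            matrix_add_rdistrib cscale_add_right cscale_mult_left cscale_mult_right cscale_cscale
            mult.commute)
      ultimately have "Re (w * trace (E ** H ** D)) + Re (cnj w * trace (H ** E ** D))
          + Re (w * cnj w * trace (E ** H ** E ** D)) \<le> 0"
        using max[of u]
        by (simp add: inner_matrix_eq D matrix_add_rdistrib trace_add cscale_mult_left trace_cscale)
      moreover have "trace (E ** H ** D) = a"
        unfolding a_def by (metis matrix_mul_assoc trace_mult_commute)
      moreover have "trace (H ** E ** D) = cnj a"
      proof -
        have "cnj a = trace (ctranspose (H ** D ** E))" by (simp add: a_def trace_ctranspose)
        also have "\<dots> = trace (E ** D ** H)" by (simp add: ctranspose_mult D H E matrix_mul_assoc)
        also have "\<dots> = trace (H ** E ** D)" by (metis matrix_mul_assoc trace_mult_commute)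
        finally show ?thesis by simp
      qed
      moreover have "Re (w * cnj w * trace (E ** H ** E ** D)) = (cmod w)\<^sup>2 * c"
        unfolding complex_norm_square[symmetric] c_def by simp
      ultimately have "Re (w * a) + Re (cnj w * cnj a) + (cmod w)\<^sup>2 * c \<le> 0"
        by (simp only:)
      then show ?thesis by (simp add: mult.commute)
    qed
    have "s\<^sup>2 * (c - Re a) \<le> s * Im a" for s :: real
    proof -
      \<comment> \<open>Cayley parametrisation
        \<open>1 + w = (1 + \<i> * s) / (1 - \<i> * s)\<close> of the unit circle: after clearing
        \<open>1 + s\<^sup>2\<close> the inequality is polynomial in the real parameter
        \<open>s\<close>.\<close>
      define w where "w = 2 * \<i> * s / (1 - \<i> * s)"
      have nz: "1 - \<i> * s \<noteq> 0" by (simp add: complex_eq_iff)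
      have pos: "1 + s\<^sup>2 > 0" by (simp add: add_pos_nonneg)
      have "1 + w = (1 + \<i> * s) / (1 - \<i> * s)"
        using nz by (simp add: w_def field_simps)
      moreover have "cmod (1 + \<i> * s) = cmod (1 - \<i> * s)" by (simp add: cmod_def)
      ultimately have "cmod (1 + w) = 1"
        using nz by (simp add: norm_divide)
      note ineq[OF this]
      moreover have "Re (w * a) = - 2 * (s\<^sup>2 * Re a + s * Im a) / (1 + s\<^sup>2)"
        using pos by (simp add: w_def Re_divide Im_divide field_simps power2_eq_square)
      moreover have "(cmod w)\<^sup>2 = 4 * s\<^sup>2 / (1 + s\<^sup>2)"
        by (simp add: w_def norm_divide norm_mult power_divide cmod_power2)
      ultimately have "2 * (- 2 * (s\<^sup>2 * Re a + s * Im a) / (1 + s\<^sup>2)) + 4 * s\<^sup>2 / (1 + s\<^sup>2) * c \<le> 0"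
        by (simp only:)
      moreover have "2 * (- 2 * (s\<^sup>2 * Re a + s * Im a) / (1 + s\<^sup>2)) + 4 * s\<^sup>2 / (1 + s\<^sup>2) * c
          = (4 * (s\<^sup>2 * (c - Re a) - s * Im a)) / (1 + s\<^sup>2)"
        unfolding divide_inverse by (simp add: algebra_simps)
      ultimately have "(4 * (s\<^sup>2 * (c - Re a) - s * Im a)) / (1 + s\<^sup>2) \<le> 0"
        by (simp only:)
      with pos show ?thesis by (simp add: divide_le_0_iff)
    qed
    then have "Im a = 0" by (rule linear_coeff_eq_0)
    then show ?thesis
      using x by (simp add: a_def E_def trace_mult_projector Im_divide_of_real del: of_real_power)
  qed
  then have "ctranspose (H ** D) = H ** D" by (rule hermitian_if_qform_real)
  then show ?thesis by (simp add: ctranspose_mult D H)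
qed

text \<open>Maximising \<open>(g Q g\<^sup>*) \<bullet> D\<close> over the unitary group, where \<open>D\<close> is diagonal with distinct
  entries, makes \<open>g Q g\<^sup>*\<close> commute with \<open>D\<close>, hence diagonal.\<close>

theorem hermitian_spectral:
  fixes Q :: "complex^'n^'n"
  assumes Q: "ctranspose Q = Q"
  shows "\<exists>g\<in>unitary_group. \<exists>d. Q = ctranspose g ** diag_mat d ** g"
proof -
  obtain f :: "'n \<Rightarrow> nat" where f: "inj f"
    using finite_imp_inj_to_nat_seg[of "UNIV :: 'n set"] by auto
  define D where "D = diag_mat (\<lambda>i. real (f i))"
  have D: "ctranspose D = D" by (simp add: D_def ctranspose_diag_mat)
  have "continuous_on unitary_group (\<lambda>g :: complex^'n^'n. (g ** Q ** ctranspose g) \<bullet> D)"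
    unfolding matrix_matrix_mult_def ctranspose_def by (intro continuous_intros)
  moreover have "(unitary_group :: (complex^'n^'n) set) \<noteq> {}"
    using one_in_unitary_group by blast
  ultimately obtain g :: "complex^'n^'n" where g: "g \<in> unitary_group"
    and max: "\<And>h. h \<in> unitary_group \<Longrightarrow>
      (h ** Q ** ctranspose h) \<bullet> D \<le> (g ** Q ** ctranspose g) \<bullet> D"
    using continuous_attains_sup[OF compact_unitary_group] by meson
  define H where "H = g ** Q ** ctranspose g"
  have H: "ctranspose H = H"
    by (simp add: H_def ctranspose_mult Q matrix_mul_assoc)
  have "H ** D = D ** H"
  proof (rule commute_if_trace_maximal[OF D H])
    fix u :: "complex^'n^'n"
    assume "u \<in> unitary_group"
    from max[OF unitary_group_mult[OF this g]]
    show "(u ** H ** ctranspose u) \<bullet> D \<le> H \<bullet> D"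
      by (simp add: H_def ctranspose_mult matrix_mul_assoc)
  qed
  \<comment> \<open>Comparing entries of \<open>H ** D\<close> and \<open>D ** H\<close>; since
    \<open>f\<close> is injective, the off-diagonal entries of \<open>H\<close> must vanish.\<close>
  then have "H $ i $ j * of_real (real (f j)) = of_real (real (f i)) * H $ i $ j" for i j
    by (metis D_def diag_mat_mult_nth mult_diag_mat_nth)
  then have off: "H $ i $ j = 0" if "i \<noteq> j" for i j
    using that inj_eq[OF f, of i j] by (metis mult.commute mult_right_cancel of_nat_eq_iff of_real_of_nat_eq)
  have "cnj (H $ i $ i) = H $ i $ i" for i
    using H unfolding ctranspose_def vec_eq_iff by simp
  then have "of_real (Re (H $ i $ i)) = H $ i $ i" for i
    by (simp add: complex_eq_iff)
  with off have "H = diag_mat (\<lambda>i. Re (H $ i $ i))"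
    by (simp add: diag_mat_def vec_eq_iff)
  moreover have "Q = ctranspose g ** H ** g"
  proof -
    have "ctranspose g ** H ** g = (ctranspose g ** g) ** Q ** (ctranspose g ** g)"
      by (simp add: H_def matrix_mul_assoc)
    then show ?thesis using g by (simp add: unitary_group_def)
  qed
  ultimately show ?thesis using g by metis
qed

section \<open>Square roots and polar decomposition\<close>

text \<open>\<open>N\<close> is the pseudo-inverse of \<open>P\<close>: in an eigenbasis it has the entries
  \<open>inverse (sqrt (d i))\<close>, where \<open>inverse 0 = 0\<close>.\<close>

lemma pos_semidef_sqrt_pinv:
  fixes Q :: "complex^'n^'n"
  assumes "pos_semidef Q"
  obtains P N where "pos_semidef P" "P ** P = Q" "ctranspose N = N" "N ** P = P ** N"
    "P ** N ** P = P" "N ** P ** N = N"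
proof -
  obtain g d where g: "g \<in> unitary_group" and Q: "Q = ctranspose g ** diag_mat d ** g"
    using hermitian_spectral[of Q] assms by (auto simp: pos_semidef_iff)
  \<comment> \<open>\<open>C e\<close> applies the eigenvalues \<open>e\<close> in the fixed
    eigenbasis. Products become pointwise products of eigenvalues, so the claimed identities reduce
    to real arithmetic.\<close>
  define C where "C e = ctranspose g ** diag_mat e ** g" for e
  have gg: "g ** ctranspose g = mat 1" using g by (simp add: unitary_group_def)
  have C_mult: "C e ** C e' = C (\<lambda>i. e i * e' i)" for e e'
  proof -
    have "C e ** C e' = ctranspose g ** diag_mat e ** (g ** ctranspose g) ** diag_mat e' ** g"
      by (simp add: C_def matrix_mul_assoc)
    also have "\<dots> = ctranspose g ** (diag_mat e ** diag_mat e') ** g"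
      by (simp add: gg matrix_mul_assoc)
    finally show ?thesis by (simp add: C_def diag_mat_mult)
  qed
  have "diag_mat d = ctranspose (ctranspose g) ** Q ** ctranspose g"
  proof -
    have "ctranspose (ctranspose g) ** Q ** ctranspose g
        = (g ** ctranspose g) ** diag_mat d ** (g ** ctranspose g)"
      by (simp add: Q matrix_mul_assoc)
    then show ?thesis by (simp add: gg)
  qed
  then have d: "d i \<ge> 0" for i
    using pos_semidef_congruence[OF assms, of "ctranspose g"] pos_semidef_diag_mat_iff by metis
  show ?thesis
  proof (rule that[of "C (\<lambda>i. sqrt (d i))" "C (\<lambda>i. inverse (sqrt (d i)))"])
    show "pos_semidef (C (\<lambda>i. sqrt (d i)))"
      unfolding C_def by (intro pos_semidef_congruence) (simp add: pos_semidef_diag_mat_iff d)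
    show "C (\<lambda>i. sqrt (d i)) ** C (\<lambda>i. sqrt (d i)) = Q"
      by (simp add: C_mult d) (simp add: C_def Q)
    show "ctranspose (C (\<lambda>i. inverse (sqrt (d i)))) = C (\<lambda>i. inverse (sqrt (d i)))"
      by (simp add: C_def ctranspose_mult ctranspose_diag_mat matrix_mul_assoc)
  qed (auto simp: C_mult mult.commute field_simps intro!: arg_cong[of _ _ C])
qed

lemma pos_semidef_factor:
  assumes "pos_semidef Q"
  obtains R where "ctranspose R = R" "R ** R = Q"
  using pos_semidef_sqrt_pinv[OF assms] pos_semidef_iff by metis

text \<open>With \<open>D = P - Q\<close>, equal squares give \<open>P ** D + D ** Q = 0\<close>.
  Pairing this with \<open>D\<close> yields a sum of two squared norms, so both terms vanish, whence
  \<open>D ** D = 0\<close> and \<open>D = 0\<close>.\<close>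

lemma pos_semidef_sqrt_unique:
  fixes P Q :: "complex^'n^'n"
  assumes P: "pos_semidef P" and Q: "pos_semidef Q" and eq: "P ** P = Q ** Q"
  shows "P = Q"
proof -
  obtain R where R: "ctranspose R = R" "R ** R = P" using pos_semidef_factor[OF P] .
  obtain S where S: "ctranspose S = S" "S ** S = Q" using pos_semidef_factor[OF Q] .
  define D where "D = P - Q"
  have D: "ctranspose D = D"
    using P Q by (simp add: D_def ctranspose_diff pos_semidef_iff)
  have "P ** D + D ** Q = 0"
    by (simp add: D_def matrix_diff_ldistrib matrix_diff_rdistrib eq)
  then have "(P ** D) \<bullet> D + (D ** Q) \<bullet> D = 0"
    by (simp flip: inner_add_left)
  moreover have "(P ** D) \<bullet> D = (R ** D) \<bullet> (R ** D)"
    using inner_mult_left[of R "R ** D" D] by (simp add: R matrix_mul_assoc)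
  moreover have "(D ** Q) \<bullet> D = (D ** S) \<bullet> (D ** S)"
    using inner_mult_right[of "D ** S" S D] by (simp add: S flip: matrix_mul_assoc)
  ultimately have "R ** D = 0" "D ** S = 0"
    by (metis add_nonneg_eq_0_iff inner_eq_zero_iff inner_ge_zero)+
  then have "P ** D = 0" "D ** Q = 0"
    by (metis R(2) matrix_mul_assoc matrix_mult_zero_right,
        metis S(2) matrix_mul_assoc matrix_mult_zero_left)
  then have "Q ** D = 0"
    by (metis D Q ctranspose_ctranspose ctranspose_mult matrix_diff_ldistrib
        matrix_mult_zero_left right_minus_eq pos_semidef_iff \<open>P ** D + D ** Q = 0\<close>)
  with \<open>P ** D = 0\<close> have "D ** D = 0"
    by (simp add: D_def matrix_diff_rdistrib)
  then have "D \<bullet> D = 0"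
    using inner_mult_left[of D "mat 1" D] by (simp add: D)
  then show ?thesis by (simp add: D_def)
qed

lemma ex1_psd_sqrt:
  assumes "pos_semidef Q"
  shows "\<exists>!P. pos_semidef P \<and> P ** P = Q"
  using pos_semidef_sqrt_pinv[OF assms] pos_semidef_sqrt_unique by metis

lemma phi_C_psd: "pos_semidef (phi_C A)"
  and phi_C_square: "phi_C A ** phi_C A = ctranspose A ** A"
  using theI'[OF ex1_psd_sqrt[OF pos_semidef_gram[of A]]]
  by (simp_all add: phi_C_def psd_sqrt_def)

text \<open>\<open>U = A ** N\<close> with \<open>N\<close> the pseudo-inverse of
  \<open>phi_C A\<close>. As \<open>A\<close> may be rectangular or rank-deficient, \<open>U\<close>
  is only a partial isometry, isometric on the range of \<open>phi_C A\<close>.\<close>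

lemma polar_decomposition:
  fixes A :: "complex^'l^'n"
  obtains U :: "complex^'l^'n" where "A = U ** phi_C A"
    "ctranspose U ** U ** phi_C A = phi_C A" "U ** ctranspose U ** U = U"
proof -
  obtain P N where PN: "pos_semidef P" "P ** P = ctranspose A ** A" "ctranspose N = N"
    "N ** P = P ** N" "P ** N ** P = P" "N ** P ** N = N"
    using pos_semidef_sqrt_pinv[OF pos_semidef_gram] .
  have P: "phi_C A = P"
    by (rule pos_semidef_sqrt_unique[OF phi_C_psd PN(1)]) (simp add: phi_C_square PN)
  define U where "U = A ** N"
  have UU: "ctranspose U ** U = P ** N"
  proof -
    have "ctranspose U ** U = N ** (ctranspose A ** A) ** N"
      by (simp add: U_def ctranspose_mult PN matrix_mul_assoc)
    also have "\<dots> = P ** N ** P ** N"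
      by (simp add: matrix_mul_assoc PN(4) flip: PN(2))
    finally show ?thesis by (simp add: PN)
  qed
  \<comment> \<open>The projector onto the kernel of \<open>P\<close>. \<open>A\<close> vanishes
    there because \<open>ctranspose A ** A = P ** P\<close>; this gives
    \<open>A = A ** N ** P\<close>.\<close>
  define E where "E = mat 1 - N ** P"
  have "(A ** E) \<bullet> (A ** E) = (P ** P ** E) \<bullet> E"
    by (subst inner_commute, subst inner_mult_left)
       (simp add: PN(2) inner_commute matrix_mul_assoc)
  also have "P ** P ** E = 0"
    using PN(5) by (simp add: E_def matrix_diff_ldistrib flip: matrix_mul_assoc)
  finally have "A ** E = 0" by simp
  then have "A = U ** P"
    by (simp add: E_def U_def matrix_diff_ldistrib matrix_mul_assoc)
  moreover have "U ** ctranspose U ** U = U"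
  proof -
    have "U ** ctranspose U ** U = U ** (P ** N)"
      by (simp add: UU flip: matrix_mul_assoc)
    also have "\<dots> = A ** (N ** P ** N)"
      by (simp add: U_def matrix_mul_assoc)
    finally show ?thesis by (simp add: PN(6) U_def)
  qed
  moreover have "ctranspose U ** U ** P = P" by (simp add: UU PN)
  ultimately show ?thesis using that P by metis
qed

section \<open>The two distance estimates\<close>

text \<open>Pythagoras: \<open>V ** ctranspose V\<close> is an orthogonal projector with complement
  \<open>E\<close>, and the squared norms of \<open>R ** V\<close> and \<open>R ** E\<close> add up
  to that of \<open>R\<close>.\<close>

lemma norm_mult_partial_isometry_le:
  fixes V :: "complex^'l^'n" and R :: "complex^'n^'m"
  assumes "V ** ctranspose V ** V = V"
  shows "(norm (R ** V))\<^sup>2 \<le> (norm R)\<^sup>2"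
proof -
  define E where "E = mat 1 - V ** ctranspose V"
  have EE: "E ** E = E" "ctranspose E = E"
    using assms by (simp_all add: E_def matrix_diff_ldistrib matrix_diff_rdistrib ctranspose_diff
        ctranspose_mult matrix_mul_assoc)
  have "(norm (R ** E))\<^sup>2 = R \<bullet> (R ** E)"
    using inner_mult_right[of R E "R ** E"] EE
    by (simp add: power2_norm_eq_inner flip: matrix_mul_assoc)
  also have "\<dots> = (norm R)\<^sup>2 - R \<bullet> (R ** V ** ctranspose V)"
    by (simp add: E_def matrix_diff_ldistrib inner_diff_right power2_norm_eq_inner matrix_mul_assoc)
  also have "R \<bullet> (R ** V ** ctranspose V) = (norm (R ** V))\<^sup>2"
    by (simp add: power2_norm_eq_inner inner_mult_right)
  finally have "(norm R)\<^sup>2 - (norm (R ** V))\<^sup>2 = (norm (R ** E))\<^sup>2" by simp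
  moreover have "(norm (R ** E))\<^sup>2 \<ge> 0" by simp
  ultimately show ?thesis by linarith
qed

lemma inner_le_half_squares: "x \<bullet> y \<le> ((norm x)\<^sup>2 + (norm y)\<^sup>2) / 2"
  for x y :: "'a::real_inner"
  using inner_ge_zero[of "x - y"]
  by (simp add: power2_norm_eq_inner inner_diff_left inner_diff_right inner_commute)

lemma power2_norm_diff: "(norm (x - y))\<^sup>2 = (norm x)\<^sup>2 + (norm y)\<^sup>2 - 2 * (x \<bullet> y)"
  for x y :: "'a::real_inner"
  by (simp add: power2_norm_eq_inner inner_diff_left inner_diff_right inner_commute)

lemma norm_phi_C: "norm (phi_C A) = norm A"
proof -
  have "ctranspose (phi_C A) = phi_C A" using phi_C_psd pos_semidef_iff by blast
  then have "(norm (phi_C A))\<^sup>2 = (norm A)\<^sup>2"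
    using inner_mult_left[of "phi_C A" "mat 1" "phi_C A"] inner_mult_left[of A "mat 1" A]
    by (simp add: power2_norm_eq_inner phi_C_square)
  then show ?thesis by (simp add: power2_eq_iff_nonneg)
qed

lemma phi_C_unitary_mult:
  assumes "g \<in> unitary_group"
  shows "phi_C (g ** A) = phi_C A"
proof -
  have "ctranspose (g ** A) ** (g ** A) = ctranspose A ** (ctranspose g ** g) ** A"
    by (simp add: ctranspose_mult matrix_mul_assoc)
  then show ?thesis using assms by (simp add: phi_C_def unitary_group_def)
qed

lemma norm_unitary_mult: "g \<in> unitary_group \<Longrightarrow> norm (g ** A) = norm A"
  by (metis norm_phi_C phi_C_unitary_mult)

lemma unitary_dist_le_phi_C:
  fixes A B :: "complex^'l^'n"
  shows "unitary_dist A B \<le> mat_dist (phi_C A) (phi_C B)"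
proof -
  obtain U where U: "A = U ** phi_C A" "ctranspose U ** U ** phi_C A = phi_C A"
    "U ** ctranspose U ** U = U" by (rule polar_decomposition)
  obtain V where V: "B = V ** phi_C B" "ctranspose V ** V ** phi_C B = phi_C B"
    "V ** ctranspose V ** V = V" by (rule polar_decomposition)
  define P Q where "P = phi_C A" and "Q = phi_C B"
  obtain g where g: "g \<in> unitary_group" and H: "pos_semidef (g ** (A ** ctranspose B))"
    using ex_unitary_mult_psd by blast
  obtain R where R: "ctranspose R = R" "R ** R = g ** (A ** ctranspose B)"
    using pos_semidef_factor[OF H] .
  \<comment> \<open>The partial isometry in the polar decomposition of \<open>g ** A\<close>, whose
    positive part is still \<open>P\<close>.\<close>
  define W where "W = g ** U"
  have gg: "ctranspose g ** g = mat 1" using g by (simp add: unitary_group_def)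
  have W: "W ** ctranspose W ** W = W"
  proof -
    have "W ** ctranspose W ** W = g ** U ** ctranspose U ** (ctranspose g ** g) ** U"
      by (simp add: W_def ctranspose_mult matrix_mul_assoc)
    also have "\<dots> = g ** (U ** ctranspose U ** U)"
      by (simp add: gg matrix_mul_assoc)
    finally show ?thesis by (simp add: U(3) W_def)
  qed
  have PW: "P = ctranspose W ** (g ** A)"
  proof -
    have "ctranspose W ** (g ** A) = ctranspose U ** (ctranspose g ** g) ** A"
      by (simp add: W_def ctranspose_mult matrix_mul_assoc)
    also have "\<dots> = ctranspose U ** (U ** P)" using U(1) by (simp add: gg P_def)
    finally show ?thesis using U(2) by (simp add: P_def matrix_mul_assoc)
  qed
  have QV: "Q = ctranspose V ** B"
    using V(1,2) unfolding Q_def by (metis matrix_mul_assoc)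
  have Qh: "ctranspose Q = Q" using phi_C_psd pos_semidef_iff Q_def by blast
  have "P \<bullet> Q = (ctranspose W ** (g ** A)) \<bullet> (ctranspose V ** B)"
    using PW QV by simp
  also have "\<dots> = (g ** A) \<bullet> (W ** ctranspose V ** B)"
    using inner_mult_left[of "ctranspose W" "g ** A" "ctranspose V ** B"]
    by (simp add: matrix_mul_assoc)
  also have "\<dots> = (g ** A ** ctranspose B) \<bullet> (W ** ctranspose V)"
    by (simp add: inner_mult_right matrix_mul_assoc)
  also have "\<dots> = (R ** R ** V) \<bullet> W"
    by (simp add: R(2) inner_mult_right matrix_mul_assoc)
  also have "\<dots> = (R ** V) \<bullet> (R ** W)"
    using inner_mult_left[of R "R ** V" W] by (simp add: R(1) matrix_mul_assoc)
  also have "\<dots> \<le> ((norm (R ** V))\<^sup>2 + (norm (R ** W))\<^sup>2) / 2"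
    by (rule inner_le_half_squares)
  also have "\<dots> \<le> (norm R)\<^sup>2"
    using add_mono[OF norm_mult_partial_isometry_le[OF V(3), of R]
        norm_mult_partial_isometry_le[OF W, of R]] by simp
  also have "\<dots> = (g ** A ** ctranspose B) \<bullet> mat 1"
    using inner_mult_left[of R R "mat 1"] R by (simp add: power2_norm_eq_inner matrix_mul_assoc)
  also have "\<dots> = (g ** A) \<bullet> B"
    by (simp add: inner_mult_right)
  finally have "P \<bullet> Q \<le> (g ** A) \<bullet> B" .
  then have "(norm (g ** A - B))\<^sup>2 \<le> (norm (P - Q))\<^sup>2"
    by (simp add: power2_norm_diff norm_unitary_mult[OF g] P_def Q_def norm_phi_C)
  then have "norm (g ** A - B) \<le> norm (P - Q)"
    by (rule power2_le_imp_le) simp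
  moreover have "unitary_dist A B \<le> norm (g ** A - B)"
    using unitary_dist_attained[of A B] g by (auto simp: mat_norm_eq_norm)
  ultimately show ?thesis by (simp add: mat_dist_def mat_norm_eq_norm P_def Q_def)
qed

text \<open>\<open>U\<close> preserves the norm of any matrix whose columns it maps isometrically.
  This removes the left factor; since \<open>P\<close> is hermitian, conjugate transposition turns
  the right factor into another left one.\<close>

lemma norm_conj_partial_isometry:
  fixes U :: "complex^'l^'n" and P :: "complex^'l^'l"
  assumes U: "ctranspose U ** U ** P = P" and P: "ctranspose P = P"
  shows "norm (U ** P ** ctranspose U) = norm P"
proof -
  have iso: "(norm (U ** X))\<^sup>2 = (norm X)\<^sup>2" if "ctranspose U ** U ** X = X" for X :: "complex^'k^'l"
    using that by (simp add: power2_norm_eq_inner inner_mult_left matrix_mul_assoc)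
  have "(norm (U ** (P ** ctranspose U)))\<^sup>2 = (norm (P ** ctranspose U))\<^sup>2"
    by (rule iso) (simp add: U matrix_mul_assoc)
  also have "\<dots> = (norm (U ** P))\<^sup>2"
    using inner_ctranspose[of "U ** P" "U ** P"]
    by (simp add: power2_norm_eq_inner ctranspose_mult P)
  also have "\<dots> = (norm P)\<^sup>2" by (rule iso) (rule U)
  finally show ?thesis by (simp add: matrix_mul_assoc power2_eq_iff_nonneg)
qed

lemma phi_C_dist_le:
  fixes A B :: "complex^'l^'n"
  shows "norm (phi_C A - phi_C B) \<le> sqrt 2 * norm (A - B)"
proof -
  obtain U where U: "A = U ** phi_C A" "ctranspose U ** U ** phi_C A = phi_C A"
    "U ** ctranspose U ** U = U" by (rule polar_decomposition)
  obtain V where V: "B = V ** phi_C B" "ctranspose V ** V ** phi_C B = phi_C B"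
    "V ** ctranspose V ** V = V" by (rule polar_decomposition)
  define P Q where "P = phi_C A" and "Q = phi_C B"
  have P: "ctranspose P = P" and Q: "ctranspose Q = Q"
    using phi_C_psd pos_semidef_iff P_def Q_def by blast+
  obtain R where R: "ctranspose R = R" "R ** R = P"
    using pos_semidef_factor[OF phi_C_psd] P_def by metis
  obtain S where S: "ctranspose S = S" "S ** S = Q"
    using pos_semidef_factor[OF phi_C_psd] Q_def by metis
  \<comment> \<open>Splitting \<open>P\<close> and \<open>Q\<close> into square roots makes
    \<open>A \<bullet> B\<close> a pairing of \<open>X\<close> with \<open>S ** R\<close>, whose
    squared norms are the two inner products compared with it.\<close>
  define X where "X = S ** ctranspose V ** U ** R"
  have "A \<bullet> B = (U ** R ** R) \<bullet> (V ** S ** S)"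
    using U(1) V(1) R(2) S(2) by (simp add: P_def Q_def flip: matrix_mul_assoc)
  also have "\<dots> = X \<bullet> (S ** R)"
    using inner_mult_left[of "V ** S" "S" "U ** R ** R"] inner_mult_right[of X R S]
    by (simp add: X_def inner_commute ctranspose_mult R S matrix_mul_assoc)
  also have "\<dots> \<le> ((norm X)\<^sup>2 + (norm (S ** R))\<^sup>2) / 2"
    by (rule inner_le_half_squares)
  also have "(norm (S ** R))\<^sup>2 = P \<bullet> Q"
    using inner_mult_left[of S R "S ** R"] inner_mult_right[of R R "Q"]
    by (simp add: power2_norm_eq_inner R S matrix_mul_assoc)
  also have "(norm X)\<^sup>2 = (U ** P ** ctranspose U) \<bullet> (V ** Q ** ctranspose V)"
  proof -
    have "(norm X)\<^sup>2 = (U ** R) \<bullet> (V ** S ** S ** ctranspose V ** U ** R)"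
      using inner_mult_left[of "S ** ctranspose V" "U ** R" X]
      by (simp add: power2_norm_eq_inner X_def ctranspose_mult S matrix_mul_assoc)
    also have "\<dots> = (U ** R ** (R ** ctranspose U)) \<bullet> (V ** S ** S ** ctranspose V)"
      using inner_mult_right[of "V ** S ** S ** ctranspose V" "U ** R" "U ** R"]
      by (simp add: ctranspose_mult R inner_commute matrix_mul_assoc)
    finally show ?thesis by (simp add: R(2)[symmetric] S(2)[symmetric] matrix_mul_assoc)
  qed
  also have "\<dots> \<le> ((norm P)\<^sup>2 + (norm Q)\<^sup>2) / 2"
    using inner_le_half_squares[of "U ** P ** ctranspose U" "V ** Q ** ctranspose V"]
      norm_conj_partial_isometry[of U P] norm_conj_partial_isometry[of V Q] U(2) V(2) P Q
    by (simp add: P_def Q_def)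
  finally have "2 * (A \<bullet> B) \<le> ((norm A)\<^sup>2 + (norm B)\<^sup>2) / 2 + P \<bullet> Q"
    by (simp add: P_def Q_def norm_phi_C)
  \<comment> \<open>Since \<open>phi_C\<close> preserves norms, this is the squared form of the
    claim, expanded and rearranged.\<close>
  then have "4 * (A \<bullet> B) \<le> (norm A)\<^sup>2 + (norm B)\<^sup>2 + 2 * (P \<bullet> Q)"
    by (simp add: field_simps)
  then have "(norm (P - Q))\<^sup>2 \<le> 2 * (norm (A - B))\<^sup>2"
    by (simp add: power2_norm_diff P_def Q_def norm_phi_C)
  then have "sqrt ((norm (P - Q))\<^sup>2) \<le> sqrt (2 * (norm (A - B))\<^sup>2)"
    by (rule real_sqrt_le_mono)
  then show ?thesis by (simp add: P_def Q_def real_sqrt_mult)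
qed

text \<open>Apply the previous bound to \<open>g ** A\<close> for a minimising \<open>g\<close>;
  \<open>phi_C\<close> is constant on unitary orbits.\<close>

lemma phi_C_dist_le_unitary_dist:
  fixes A B :: "complex^'l^'n"
  shows "mat_dist (phi_C A) (phi_C B) \<le> sqrt 2 * unitary_dist A B"
proof -
  obtain g where "g \<in> unitary_group" "unitary_dist A B = norm (g ** A - B)"
    using unitary_dist_attained[of A B] by (auto simp: mat_norm_eq_norm)
  then show ?thesis
    using phi_C_dist_le[of "g ** A" B] by (simp add: phi_C_unitary_mult mat_dist_def mat_norm_eq_norm)
qed

section \<open>The space of hermitian matrices\<close>

lemma subspace_hermitian_mats: "subspace (hermitian_mats :: (complex^'l^'l) set)"
  by (rule subspaceI) (auto simp: hermitian_mats_def ctranspose_def vec_eq_iff)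

text \<open>Every matrix is uniquely \<open>X + \<i> Y\<close> with \<open>X\<close>, \<open>Y\<close> hermitian, so the hermitian matrices have half
  the real dimension \<open>2 l\<^sup>2\<close> of the whole space.\<close>

lemma dim_hermitian_mats: "dim (hermitian_mats :: (complex^'l^'l) set) = CARD('l) ^ 2"
proof -
  let ?H = "hermitian_mats :: (complex^'l^'l) set"
  have lin: "linear (cscale \<i> :: complex^'l^'l \<Rightarrow> _)"
    by (rule linearI) (simp_all add: cscale_def vec_eq_iff algebra_simps)
  have inj: "inj (cscale \<i> :: complex^'l^'l \<Rightarrow> _)"
    by (rule injI) (simp add: cscale_def vec_eq_iff)
  \<comment> \<open>Multiplication by \<open>\<i>\<close> is a real-linear injection onto the
    skew-hermitian matrices, which meet the hermitian ones only in \<open>0\<close>.\<close>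
  have skew: "ctranspose X = - X" if "X \<in> cscale \<i> ` ?H" for X
    using that by (auto simp: hermitian_mats_def ctranspose_cscale) (simp add: cscale_def vec_eq_iff)
  have "?H \<inter> cscale \<i> ` ?H \<subseteq> {0}"
  proof
    fix X assume "X \<in> ?H \<inter> cscale \<i> ` ?H"
    with skew[of X] have "X = - X" by (auto simp: hermitian_mats_def)
    then show "X \<in> {0}" by (simp add: vec_eq_iff complex_eq_iff)
  qed
  then have int: "dim (?H \<inter> cscale \<i> ` ?H) = 0" by simp
  have "X \<in> {x + y |x y. x \<in> ?H \<and> y \<in> cscale \<i> ` ?H}" for X :: "complex^'l^'l"
  proof -
    \<comment> \<open>The matrix analogues of the real and imaginary parts of a complex
      number.\<close>
    define Y where "Y = cscale (1/2) (X + ctranspose X)"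
    define Z where "Z = cscale (- \<i> / 2) (X - ctranspose X)"
    have "Y \<in> ?H" "Z \<in> ?H"
      by (simp_all add: Y_def Z_def hermitian_mats_def cscale_def ctranspose_def vec_eq_iff algebra_simps)
    moreover have "X = Y + cscale \<i> Z"
      by (simp add: Y_def Z_def cscale_def vec_eq_iff algebra_simps)
    ultimately show ?thesis by blast
  qed
  then have "{x + y |x y. x \<in> ?H \<and> y \<in> cscale \<i> ` ?H} = UNIV" by blast
  then have "dim ?H + dim (cscale \<i> ` ?H) = DIM(complex^'l^'l)"
    using dim_sums_Int[OF subspace_hermitian_mats linear_subspace_image[OF lin subspace_hermitian_mats]]
      int by simp
  moreover have "dim (cscale \<i> ` ?H) = dim ?H"
    by (rule dim_image_eq[OF lin]) (rule inj_on_subset[OF inj], simp)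
  ultimately show ?thesis by (simp add: power2_eq_square)
qed

text \<open>The first conjunct ensures that the definite description behind \<open>phi_C\<close>
  denotes the square root; \<open>subspace\<close> and \<open>dim\<close> refer to the real vector
  space structure.\<close>

theorem theorem5:
  shows "(\<forall>A :: complex^'l^'n. \<exists>!P. pos_semidef P \<and> P ** P = ctranspose A ** A) \<and>
    (\<forall>A B :: complex^'l^'n.
       unitary_dist A B \<le> mat_dist (phi_C A) (phi_C B) \<and>
       mat_dist (phi_C A) (phi_C B) \<le> sqrt 2 * unitary_dist A B) \<and>
    range (phi_C :: complex^'l^'n \<Rightarrow> complex^'l^'l) \<subseteq> hermitian_mats \<and>
    subspace (hermitian_mats :: (complex^'l^'l) set) \<and>
    dim (hermitian_mats :: (complex^'l^'l) set) = CARD('l) ^ 2"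
proof (intro conjI allI)
  show "\<exists>!P. pos_semidef P \<and> P ** P = ctranspose A ** A" for A :: "complex^'l^'n"
    by (rule ex1_psd_sqrt[OF pos_semidef_gram])
  show "range (phi_C :: complex^'l^'n \<Rightarrow> complex^'l^'l) \<subseteq> hermitian_mats"
    using phi_C_psd by (auto simp: pos_semidef_def)
qed (rule unitary_dist_le_phi_C phi_C_dist_le_unitary_dist subspace_hermitian_mats
    dim_hermitian_mats)+

end
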